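(* Let $\lambda=[\lambda_1,\ldots,\lambda_k]$ be a partition with frequency representation $[a_1,\ldots,a_{\lambda_1}]$, and let $n$ be a positive integer. Then the polytope $P(\lambda,n)$ consists exactly of all real $\lambda_1\times n$ matrices $X=(X_{ij})$ such that (i) $0\le \sum_{i'=1}^{i}X_{i'j}\le 1$ for all $1\le i\le \lambda_1$, $1\le j\le n$; (ii) $0\le \sum_{j'=1}^{j}X_{ij'}$ for all $1\le i\le\lambda_1$, $1\le j\le n$; (iii) $\sum_{j'=1}^{n}X_{ij'}=a_{\lambda_1-i+1}$ for all $1\le i\le \lambda_1$.
   Context: A partition $\lambda=[\lambda_1,\ldots,\lambda_k]$ is a weakly decreasing sequence of positive integers; $k$ is its length. Its frequency representation is $[a_1,\ldots,a_{\lambda_1}]$, where $a_i$ is the number of parts of $\lambda$ equal to $i$. A sign matrix is a matrix $M=(M_{ij})$ with entries in $\{-1,0,1\}$ such that every column partial sum from the top $\sum_{i'=1}^{i}M_{i'j}$ lies in $\{0,1\}$ and every row partial sum from the left $\sum_{j'=1}^{j}M_{ij'}$ is nonnegative. $M(\lambda,n)$ denotes the set of $\lambda_1\times n$ sign matrices whose $i$-th row has total sum $a_{\lambda_1-i+1}$ for each $1\le i\le\lambda_1$. $P(\lambda,n)$ is the convex hull of $M(\lambda,n)$ in $\mathbb{R}^{\lambda_1 n}$. *)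

theory Defs
  imports "HOL-Analysis.Analysis" "HOL-Analysis.Finite_Function_Topology"
begin

definition is_partition :: "nat list \<Rightarrow> bool" where
  "is_partition lam \<longleftrightarrow> sorted_wrt (\<ge>) lam \<and> (\<forall>p \<in> set lam. 0 < p)"

text \<open>\<open>first_part lam\<close> is $\lambda_1$; for the empty partition we use the convention $\lambda_1 = 0$.\<close>

definition first_part :: "nat list \<Rightarrow> nat" where
  "first_part lam = (case lam of [] \<Rightarrow> 0 | p # _ \<Rightarrow> p)"

definition freq :: "nat list \<Rightarrow> nat \<Rightarrow> nat" where
  "freq lam i = count_list lam i"

text \<open>
  The sizes of the matrices are values, not types. The space of real \<open>m \<times> n\<close> matrices is
  represented as the subspace \<open>matrices m n\<close> of the real vector space of finitely supported
  functions on pairs of naturals: those supported on \<open>{1..m} \<times> {1..n}\<close>. Rows and columns are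
  numbered from 1, row 1 on top and column 1 on the left, and the entries outside the index
  range are 0. The library's \<open>convex hull\<close> applies directly.
\<close>

type_synonym rmatrix = "(nat \<times> nat) \<Rightarrow>\<^sub>0 real"

abbreviation entry :: "rmatrix \<Rightarrow> nat \<Rightarrow> nat \<Rightarrow> real" where
  "entry X i j \<equiv> Poly_Mapping.lookup X (i, j)"

definition matrices :: "nat \<Rightarrow> nat \<Rightarrow> rmatrix set" where
  "matrices m n = {X. Poly_Mapping.keys X \<subseteq> {1..m} \<times> {1..n}}"

definition sign_matrices :: "nat \<Rightarrow> nat \<Rightarrow> rmatrix set" where
  "sign_matrices m n = {M \<in> matrices m n.
     (\<forall>i\<in>{1..m}. \<forall>j\<in>{1..n}. entry M i j \<in> {-1, 0, 1}) \<and>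
     (\<forall>i\<in>{1..m}. \<forall>j\<in>{1..n}. (\<Sum>i'=1..i. entry M i' j) \<in> {0, 1}) \<and>
     (\<forall>i\<in>{1..m}. \<forall>j\<in>{1..n}. 0 \<le> (\<Sum>j'=1..j. entry M i j'))}"

text \<open>$M(\lambda, n)$: the frequencies are read from the largest part size (top row) downwards.
The subtraction does not truncate, as \<open>i \<le> first_part lam\<close>.\<close>

definition shape_sign_matrices :: "nat list \<Rightarrow> nat \<Rightarrow> rmatrix set" where
  "shape_sign_matrices lam n = {M \<in> sign_matrices (first_part lam) n.
     \<forall>i\<in>{1..first_part lam}.
       (\<Sum>j'=1..n. entry M i j') = real (freq lam (first_part lam - i + 1))}"

definition shape_polytope :: "nat list \<Rightarrow> nat \<Rightarrow> rmatrix set" where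
  "shape_polytope lam n = convex hull (shape_sign_matrices lam n)"

end

theory Submission
  imports Defs
begin

text \<open>
  Let \<open>P i j\<close> be the sum of the entries of \<open>X\<close> in the first \<open>i\<close> rows and first \<open>j\<close> columns.
  The inequalities say that \<open>P i j - P i (j - 1)\<close> lies in \<open>[0, 1]\<close> and that \<open>P\<close> is monotone in
  \<open>i\<close>, while \<open>P i n\<close> is an integer. Replacing \<open>P\<close> by \<open>\<lfloor>P + 1 - t\<rfloor>\<close> with \<open>0 < t \<le> 1\<close> preserves all of
  this and makes the partial sums integral, so the matrix of mixed differences of \<open>\<lfloor>P + 1 - t\<rfloor>\<close>
  is a sign matrix with the same row sums. Averaging over \<open>t\<close> recovers \<open>P\<close>, because \<open>\<lfloor>p + 1 - t\<rfloor>\<close>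
  has mean \<open>p\<close>; only finitely many values of \<open>t\<close> matter, so \<open>X\<close> is a finite convex combination.
\<close>

text \<open>Weight each element of \<open>F\<close> by its gap to the preceding one, the smallest by
  its distance from 0; the weights up to \<open>f\<close> then telescope to
  \<open>f\<close>.\<close>

lemma layer_cake_weights:
  fixes F :: "real set"
  assumes "finite F" "F \<subseteq> {0<..}"
  shows "\<exists>w. (\<forall>t\<in>F. 0 \<le> w t) \<and> (\<forall>f\<in>F. (\<Sum>t\<in>{t\<in>F. t \<le> f}. w t) = f)"
  using assms
proof (induction F rule: finite_linorder_max_induct)
  case (insert b F)
  then obtain w where w: "\<forall>t\<in>F. 0 \<le> w t" "\<forall>f\<in>F. (\<Sum>t\<in>{t\<in>F. t \<le> f}. w t) = f"
    by auto
  \<comment> \<open>By the induction hypothesis \<open>sum w F\<close> is the maximum of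
    \<open>F\<close>, or 0 if \<open>F\<close> is empty, so \<open>b - sum w F\<close> is the new
    gap.\<close>
  have le: "sum w F \<le> b"
  proof (cases "F = {}")
    case False
    then have "{t\<in>F. t \<le> Max F} = F" "Max F \<in> F" using insert.hyps by auto
    then have "sum w F = Max F" using w(2) by metis
    then show ?thesis using \<open>Max F \<in> F\<close> insert.hyps by force
  qed (use insert.prems in auto)
  define w' where "w' = w(b := b - sum w F)"
  have b: "b \<notin> F" using insert.hyps by auto
  have w': "sum w' A = sum w A" if "A \<subseteq> F" for A
    using that b by (intro sum.cong) (auto simp: w'_def)
  have "(\<Sum>t\<in>{t \<in> insert b F. t \<le> f}. w' t) = f" if f: "f \<in> insert b F" for f
  proof (cases "f = b")
    case True
    then have "{t \<in> insert b F. t \<le> f} = insert b F" using insert.hyps by auto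
    then show ?thesis using True b insert.hyps w'[of F] by (simp add: w'_def)
  next
    case False
    then have "{t \<in> insert b F. t \<le> f} = {t \<in> F. t \<le> f}" using f insert.hyps by force
    then show ?thesis using w(2) w'[of "{t \<in> F. t \<le> f}"] False f by auto
  qed
  moreover have "\<forall>t\<in>insert b F. 0 \<le> w' t" using le w(1) by (auto simp: w'_def)
  ultimately show ?case by blast
qed simp

text \<open>The threshold \<open>t\<close> matters only through its comparison with
  \<open>frac p\<close>. Hence a weighting of thresholds with total 1 averages the floors to
  \<open>p\<close> as soon as those up to \<open>frac p\<close> weigh \<open>frac p\<close>.\<close>

lemma floor_add_one_minus:
  fixes p t :: real
  assumes "0 < t" "t \<le> 1"
  shows "\<lfloor>p + 1 - t\<rfloor> = \<lfloor>p\<rfloor> + (if t \<le> frac p then 1 else 0)"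
  using assms by (simp add: frac_def) linarith

lemma floor_average_weights:
  fixes P :: "real set"
  assumes "finite P"
  obtains T w where "finite T" "T \<subseteq> {0<..1}" "\<And>t. t \<in> T \<Longrightarrow> 0 \<le> w t" "sum w T = 1"
    "\<And>p. p \<in> P \<Longrightarrow> (\<Sum>t\<in>T. w t * real_of_int \<lfloor>p + 1 - t\<rfloor>) = p"
proof -
  \<comment> \<open>The element 1 forces the total weight to be 1. The value 0 is removed because
    layer cake weights require positive elements; for integral \<open>p\<close> no threshold lies
    below \<open>frac p\<close> and the sum is empty.\<close>
  define T where "T = insert 1 (frac ` P - {0})"
  have T: "finite T" "T \<subseteq> {0<..1}"
    using assms by (auto simp: T_def less_imp_le[OF frac_lt_1])
  then obtain w where w: "\<forall>t\<in>T. 0 \<le> w t" "\<forall>f\<in>T. (\<Sum>t\<in>{t\<in>T. t \<le> f}. w t) = f"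
    using layer_cake_weights[of T] by force
  have "{t\<in>T. t \<le> 1} = T" using T by auto
  then have one: "sum w T = 1" using w(2) by (metis T_def insertI1)
  have "(\<Sum>t\<in>T. w t * real_of_int \<lfloor>p + 1 - t\<rfloor>) = p" if "p \<in> P" for p
  proof -
    have "(\<Sum>t\<in>T. w t * real_of_int \<lfloor>p + 1 - t\<rfloor>)
        = (\<Sum>t\<in>T. w t * \<lfloor>p\<rfloor> + (if t \<le> frac p then w t else 0))"
      using T(2) by (intro sum.cong) (auto simp: floor_add_one_minus distrib_left)
    also have "\<dots> = \<lfloor>p\<rfloor> + (\<Sum>t\<in>{t\<in>T. t \<le> frac p}. w t)"
      using T(1) one by (simp add: sum.distrib sum.inter_filter flip: sum_distrib_right)
    also have "(\<Sum>t\<in>{t\<in>T. t \<le> frac p}. w t) = frac p"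
    proof (cases "frac p = 0")
      case True
      then have "{t\<in>T. t \<le> frac p} = {}" using T(2) unfolding True by force
      then show ?thesis by (simp only: sum.empty True)
    qed (use w(2) that in \<open>auto simp: T_def\<close>)
    finally show ?thesis by (simp add: frac_def)
  qed
  then show thesis using that T w(1) one by blast
qed

definition mixed_diff :: "(nat \<Rightarrow> nat \<Rightarrow> real) \<Rightarrow> nat \<Rightarrow> nat \<Rightarrow> real" where
  "mixed_diff q i j = q i j - q (i - 1) j - q i (j - 1) + q (i - 1) (j - 1)"

lemma sum_mixed_diff_col:
  "(\<Sum>i'=1..i. mixed_diff q i' j) = (q i j - q i (j - 1)) - (q 0 j - q 0 (j - 1))"
  using sum_telescope''[of 0 i "\<lambda>i. q i j - q i (j - 1)"]
  by (simp add: mixed_diff_def algebra_simps)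

lemma sum_mixed_diff_row:
  "(\<Sum>j'=1..j. mixed_diff q i j') = (q i j - q (i - 1) j) - (q i 0 - q (i - 1) 0)"
  using sum_telescope''[of 0 j "\<lambda>j. q i j - q (i - 1) j"]
  by (simp add: mixed_diff_def algebra_simps)

text \<open>The cut-off makes the support finite, as \<open>Abs_poly_mapping\<close> requires, and
  keeps the truncated differences \<open>0 - 1\<close> in \<open>mixed_diff\<close> out of
  play.\<close>

definition diff_matrix :: "nat \<Rightarrow> nat \<Rightarrow> (nat \<Rightarrow> nat \<Rightarrow> real) \<Rightarrow> rmatrix" where
  "diff_matrix m n q =
     Abs_poly_mapping (\<lambda>(i, j). if i \<in> {1..m} \<and> j \<in> {1..n} then mixed_diff q i j else 0)"

lemma entry_diff_matrix:
  "entry (diff_matrix m n q) i j = (if i \<in> {1..m} \<and> j \<in> {1..n} then mixed_diff q i j else 0)"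
proof -
  have "finite {x. (case x of (i, j) \<Rightarrow>
      if i \<in> {1..m} \<and> j \<in> {1..n} then mixed_diff q i j else 0) \<noteq> 0}"
    by (rule finite_subset[of _ "{1..m} \<times> {1..n}"]) (auto split: if_splits)
  then show ?thesis by (simp add: diff_matrix_def)
qed

lemma diff_matrix_in_matrices: "diff_matrix m n q \<in> matrices m n"
  by (auto simp: matrices_def in_keys_iff entry_diff_matrix split: if_splits)

lemma diff_matrix_col:
  assumes "i \<le> m" "j \<in> {1..n}"
  shows "(\<Sum>i'=1..i. entry (diff_matrix m n q) i' j)
    = (q i j - q i (j - 1)) - (q 0 j - q 0 (j - 1))"
proof -
  have "(\<Sum>i'=1..i. entry (diff_matrix m n q) i' j) = (\<Sum>i'=1..i. mixed_diff q i' j)"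
    using assms by (intro sum.cong) (auto simp: entry_diff_matrix)
  then show ?thesis by (simp only: sum_mixed_diff_col)
qed

lemma diff_matrix_row:
  assumes "i \<in> {1..m}" "j \<le> n"
  shows "(\<Sum>j'=1..j. entry (diff_matrix m n q) i j')
    = (q i j - q (i - 1) j) - (q i 0 - q (i - 1) 0)"
proof -
  have "(\<Sum>j'=1..j. entry (diff_matrix m n q) i j') = (\<Sum>j'=1..j. mixed_diff q i j')"
    using assms by (intro sum.cong) (auto simp: entry_diff_matrix)
  then show ?thesis by (simp only: sum_mixed_diff_row)
qed

definition corner_sum :: "rmatrix \<Rightarrow> nat \<Rightarrow> nat \<Rightarrow> real" where
  "corner_sum X i j = (\<Sum>i'=1..i. \<Sum>j'=1..j. entry X i' j')"

lemma corner_sum_0 [simp]: "corner_sum X 0 j = 0" "corner_sum X i 0 = 0"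
  by (simp_all add: corner_sum_def)

lemma corner_sum_row:
  assumes "1 \<le> i"
  shows "corner_sum X i j = corner_sum X (i - 1) j + (\<Sum>j'=1..j. entry X i j')"
  using assms by (cases i) (simp_all add: corner_sum_def)

lemma corner_sum_col:
  assumes "1 \<le> j"
  shows "corner_sum X i j = corner_sum X i (j - 1) + (\<Sum>i'=1..i. entry X i' j)"
  using assms by (cases j) (simp_all add: corner_sum_def sum.distrib)

lemma mixed_diff_corner_sum:
  assumes "1 \<le> i" "1 \<le> j"
  shows "mixed_diff (corner_sum X) i j = entry X i j"
proof -
  obtain j0 where "j = Suc j0" using assms(2) by (cases j) auto
  then show ?thesis
    using corner_sum_row[OF assms(1), of X j] corner_sum_row[OF assms(1), of X "j - 1"]
    by (simp add: mixed_diff_def)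
qed

lemma lookup_scaleR:
  fixes X :: "'a \<Rightarrow>\<^sub>0 real"
  shows "Poly_Mapping.lookup (c *\<^sub>R X) k = c * Poly_Mapping.lookup X k"
proof -
  have "finite {k. c *\<^sub>R Poly_Mapping.lookup X k \<noteq> 0}"
    by (rule finite_subset[of _ "Poly_Mapping.keys X"]) (auto simp: in_keys_iff)
  then show ?thesis by (simp add: scaleR_poly_mapping_def)
qed

text \<open>The inequality description for arbitrary row sums \<open>r\<close>; the frequencies of a
  partition are one integral choice.\<close>

definition sum_polytope :: "nat \<Rightarrow> nat \<Rightarrow> (nat \<Rightarrow> real) \<Rightarrow> rmatrix set" where
  "sum_polytope m n r = {X \<in> matrices m n.
       (\<forall>i\<in>{1..m}. \<forall>j\<in>{1..n}.
          0 \<le> (\<Sum>i'=1..i. entry X i' j) \<and> (\<Sum>i'=1..i. entry X i' j) \<le> 1) \<and>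
       (\<forall>i\<in>{1..m}. \<forall>j\<in>{1..n}. 0 \<le> (\<Sum>j'=1..j. entry X i j')) \<and>
       (\<forall>i\<in>{1..m}. (\<Sum>j'=1..n. entry X i j') = r i)}"

lemma convex_sum_polytope: "convex (sum_polytope m n r)"
proof (rule convexI)
  fix X Y :: rmatrix and u v :: real
  assume X: "X \<in> sum_polytope m n r" and Y: "Y \<in> sum_polytope m n r"
    and uv: "0 \<le> u" "0 \<le> v" "u + v = 1"
  let ?Z = "u *\<^sub>R X + v *\<^sub>R Y"
  have col: "(\<Sum>i'=1..i. entry ?Z i' j) = u * (\<Sum>i'=1..i. entry X i' j) + v * (\<Sum>i'=1..i. entry Y i' j)"
    and row: "(\<Sum>j'=1..k. entry ?Z i j') = u * (\<Sum>j'=1..k. entry X i j') + v * (\<Sum>j'=1..k. entry Y i j')"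
    for i j k
    by (simp_all add: lookup_add lookup_scaleR sum.distrib sum_distrib_left)
  have "?Z \<in> matrices m n"
  proof -
    have "Poly_Mapping.keys ?Z \<subseteq> Poly_Mapping.keys X \<union> Poly_Mapping.keys Y"
      by (auto simp: in_keys_iff lookup_add lookup_scaleR)
    then show ?thesis using X Y unfolding sum_polytope_def matrices_def by blast
  qed
  moreover have "u * r i + v * r i = r i" for i
    using uv(3) by (simp flip: distrib_right)
  ultimately show "?Z \<in> sum_polytope m n r"
    using X Y uv unfolding sum_polytope_def mem_Collect_eq col row
    by (simp add: convex_bound_le)
qed

text \<open>The floor turns an increment in [0, 1] into 0 or 1, is monotone, and commutes with
  adding an integer. These facts give the column condition, the row condition and the row sums, in
  this order.\<close>

lemma floor_diff_matrix_sign: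
  assumes X: "X \<in> sum_polytope m n r" and r: "\<And>i. i \<in> {1..m} \<Longrightarrow> r i \<in> \<int>"
    and t: "0 < t" "t \<le> 1"
  defines "M \<equiv> diff_matrix m n (\<lambda>i j. real_of_int \<lfloor>corner_sum X i j + 1 - t\<rfloor>)"
  shows "M \<in> sign_matrices m n" "\<And>i. i \<in> {1..m} \<Longrightarrow> (\<Sum>j'=1..n. entry M i j') = r i"
proof -
  let ?q = "\<lambda>i j. real_of_int \<lfloor>corner_sum X i j + 1 - t\<rfloor>"
  \<comment> \<open>On the border the corner sums vanish, and \<open>1 - t\<close> lies in [0, 1),
    so no boundary terms survive telescoping.\<close>
  have zero: "?q 0 j = 0" "?q i 0 = 0" for i j
    using t by (simp_all add: floor_eq_iff)
  \<comment> \<open>The case \<open>i = 0\<close> is included so that first-row entries, too, are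
    differences of two partial sums in {0, 1}.\<close>
  have col: "(\<Sum>i'=1..i. entry M i' j) \<in> {0, 1}" if "i \<le> m" "j \<in> {1..n}" for i j
  proof (cases "i = 0")
    case False
    then have "corner_sum X i (j - 1) \<le> corner_sum X i j"
        "corner_sum X i j \<le> corner_sum X i (j - 1) + 1"
      using X that corner_sum_col[of j X i] by (auto simp: sum_polytope_def)
    then have "\<lfloor>corner_sum X i j + 1 - t\<rfloor> - \<lfloor>corner_sum X i (j - 1) + 1 - t\<rfloor> \<in> {0, 1}"
      by simp linarith
    moreover have "(\<Sum>i'=1..i. entry M i' j)
      = of_int (\<lfloor>corner_sum X i j + 1 - t\<rfloor> - \<lfloor>corner_sum X i (j - 1) + 1 - t\<rfloor>)"
      unfolding M_def diff_matrix_col[OF that] zero by simp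
    ultimately show ?thesis by force
  qed simp
  have row: "(\<Sum>j'=1..j. entry M i j') = ?q i j - ?q (i - 1) j"
    if "i \<in> {1..m}" "j \<le> n" for i j
    unfolding M_def diff_matrix_row[OF that] zero by simp
  have "0 \<le> (\<Sum>j'=1..j. entry M i j')" if "i \<in> {1..m}" "j \<in> {1..n}" for i j
  proof -
    have "corner_sum X (i - 1) j \<le> corner_sum X i j"
      using X that corner_sum_row[of i X j] by (auto simp: sum_polytope_def)
    then show ?thesis using row[of i j] that by (simp add: floor_mono)
  qed
  moreover have "entry M i j \<in> {-1, 0, 1}" if "i \<in> {1..m}" "j \<in> {1..n}" for i j
  proof -
    obtain i0 where "i = Suc i0" using \<open>i \<in> {1..m}\<close> by (cases i) auto
    then have "entry M i j = (\<Sum>i'=1..i. entry M i' j) - (\<Sum>i'=1..i0. entry M i' j)"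
      by simp
    then show ?thesis using col[of i j] col[of i0 j] that \<open>i = Suc i0\<close> by auto
  qed
  ultimately show "M \<in> sign_matrices m n"
    using col by (auto simp: sign_matrices_def M_def diff_matrix_in_matrices)
  fix i assume i: "i \<in> {1..m}"
  then obtain k where k: "r i = of_int k" using r Ints_cases by blast
  have "(\<Sum>j'=1..n. entry X i j') = r i" using X i by (simp add: sum_polytope_def)
  then have "corner_sum X i n + 1 - t = (corner_sum X (i - 1) n + 1 - t) + of_int k"
    using i corner_sum_row[of i X n] k by simp
  then have "?q i n = ?q (i - 1) n + k" by (simp only: floor_add_int[symmetric] of_int_add)
  then show "(\<Sum>j'=1..n. entry M i j') = r i" using row[of i n] i k by simp
qed

lemma sum_polytope_eq_convex_hull:
  assumes r: "\<And>i. i \<in> {1..m} \<Longrightarrow> r i \<in> \<int>"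
  shows "convex hull {M \<in> sign_matrices m n. \<forall>i\<in>{1..m}. (\<Sum>j'=1..n. entry M i j') = r i}
    = sum_polytope m n r" (is "convex hull ?V = _")
proof
  have "?V \<subseteq> sum_polytope m n r"
    by (fastforce simp: sum_polytope_def sign_matrices_def)
  then show "convex hull ?V \<subseteq> sum_polytope m n r"
    by (rule hull_minimal) (rule convex_sum_polytope)
  show "sum_polytope m n r \<subseteq> convex hull ?V"
  proof
    fix X assume X: "X \<in> sum_polytope m n r"
    obtain T w where T: "finite T" "T \<subseteq> {0<..1}" and w: "\<And>t. t \<in> T \<Longrightarrow> 0 \<le> w t" "sum w T = 1"
      and avg: "\<And>p. p \<in> (\<lambda>(i, j). corner_sum X i j) ` ({0..m} \<times> {0..n}) \<Longrightarrow>
        (\<Sum>t\<in>T. w t * real_of_int \<lfloor>p + 1 - t\<rfloor>) = p"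
      \<comment> \<open>One choice of weights must serve all corner sums at once, including index 0,
        which the mixed differences in the first row and column use.\<close>
      using floor_average_weights[of "(\<lambda>(i, j). corner_sum X i j) ` ({0..m} \<times> {0..n})"]
      by auto
    let ?q = "\<lambda>t i j. real_of_int \<lfloor>corner_sum X i j + 1 - t\<rfloor>"
    let ?M = "\<lambda>t. diff_matrix m n (?q t)"
    have avg_corner: "(\<Sum>t\<in>T. w t * ?q t i j) = corner_sum X i j" if "i \<le> m" "j \<le> n" for i j
      using that by (intro avg) auto
    have "X = (\<Sum>t\<in>T. w t *\<^sub>R ?M t)"
    proof (rule poly_mapping_eqI)
      fix k :: "nat \<times> nat"
      obtain i j where k: "k = (i, j)" by (cases k)
      have "entry X i j = (\<Sum>t\<in>T. w t * entry (?M t) i j)"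
      proof (cases "i \<in> {1..m} \<and> j \<in> {1..n}")
        case True
        then have "i \<le> m" "i - 1 \<le> m" "j \<le> n" "j - 1 \<le> n" by auto
        \<comment> \<open>Mixed differences are linear, so averaging the matrices amounts to
          averaging their corner sums.\<close>
        have "(\<Sum>t\<in>T. w t * entry (?M t) i j) = mixed_diff (\<lambda>i j. \<Sum>t\<in>T. w t * ?q t i j) i j"
          using True
          by (simp add: entry_diff_matrix mixed_diff_def distrib_left right_diff_distrib
              sum.distrib sum_subtractf)
        also have "\<dots> = mixed_diff (corner_sum X) i j"
          unfolding mixed_diff_def
          by (simp only: avg_corner \<open>i \<le> m\<close> \<open>i - 1 \<le> m\<close> \<open>j \<le> n\<close> \<open>j - 1 \<le> n\<close>)
        finally show ?thesis using True by (simp add: mixed_diff_corner_sum)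
      next
        case False
        moreover have "(i, j) \<notin> Poly_Mapping.keys X"
          using X False by (auto simp: sum_polytope_def matrices_def)
        ultimately show ?thesis by (auto simp: in_keys_iff entry_diff_matrix)
      qed
      then show "Poly_Mapping.lookup X k = Poly_Mapping.lookup (\<Sum>t\<in>T. w t *\<^sub>R ?M t) k"
        by (simp add: k lookup_sum lookup_scaleR)
    qed
    also have "\<dots> \<in> convex hull ?V"
    proof (rule convex_sum[OF T(1) convex_convex_hull w(2,1)])
      fix t assume "t \<in> T"
      then have "0 < t" "t \<le> 1" using T(2) by auto
      then have "?M t \<in> ?V" using floor_diff_matrix_sign[OF X r] by simp
      then show "?M t \<in> convex hull ?V" by (rule hull_inc)
    qed
    finally show "X \<in> convex hull ?V" .
  qed
qed

theorem theorem5p1: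
  fixes lam :: "nat list" and n :: nat
  assumes "is_partition lam" and "1 \<le> n"
  shows "shape_polytope lam n =
    {X \<in> matrices (first_part lam) n.
       (\<forall>i\<in>{1..first_part lam}. \<forall>j\<in>{1..n}.
          0 \<le> (\<Sum>i'=1..i. entry X i' j) \<and> (\<Sum>i'=1..i. entry X i' j) \<le> 1) \<and>
       (\<forall>i\<in>{1..first_part lam}. \<forall>j\<in>{1..n}.
          0 \<le> (\<Sum>j'=1..j. entry X i j')) \<and>
       (\<forall>i\<in>{1..first_part lam}.
          (\<Sum>j'=1..n. entry X i j') = real (freq lam (first_part lam - i + 1)))}"
  using sum_polytope_eq_convex_hull[of "first_part lam"
      "\<lambda>i. real (freq lam (first_part lam - i + 1))" n]
  by (simp add: shape_polytope_def shape_sign_matrices_def sum_polytope_def)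

end
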